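(* Let $f$ be a uniformly continuous bounded real-valued function on $[0,\infty)$, $x\ge\frac12$ and $n\in\mathbb{N}$. Then $$|K_n^{\ast}(f;x)-f(x)|\le 2\,\omega(f;\delta_{n,x}^{\ast}),$$ where $$\delta_{n,x}^{\ast}=\sqrt{\frac1{(n+\beta)^2}\left\{\beta^2x^2+\left(n-2\alpha\beta+2n\mu\frac{e_\mu(-nr_n(x))}{e_\mu(nr_n(x))}\right)x+\alpha^2-\left(\frac5{12}+\mu\frac{e_\mu(-nr_n(x))}{e_\mu(nr_n(x))}\right)\right\}}.$$
   Context: Fix real numbers $\mu\ge 0$, $\alpha\ge 0$, $\beta\ge 0$. Let $\theta_k=0$ for even integers $k\ge 0$ and $\theta_k=1$ for odd $k$. For integers $k\ge 0$ set $$\gamma_\mu(2k)=\frac{2^{2k}k!\,\Gamma(k+\mu+\frac12)}{\Gamma(\mu+\frac12)},\qquad \gamma_\mu(2k+1)=\frac{2^{2k+1}k!\,\Gamma(k+\mu+\frac32)}{\Gamma(\mu+\frac12)},$$ so that $\gamma_\mu(k+1)=(k+1+2\mu\theta_{k+1})\gamma_\mu(k)$, and let $e_\mu(x)=\sum_{k=0}^\infty \frac{x^k}{\gamma_\mu(k)}$ for real $x$. For $n\in\mathbb{N}=\{1,2,\dots\}$ and $x\ge\frac12$ let $r_n(x)=x-\frac1{2n}$ and define $$K_n^{\ast}(f;x)=\frac{n}{e_\mu(nr_n(x))}\sum_{k=0}^\infty\frac{(nr_n(x))^k}{\gamma_\mu(k)}\int_{\frac{k+2\mu\theta_k}{n}}^{\frac{k+1+2\mu\theta_k}{n}}f\left(\frac{nt+\alpha}{n+\beta}\right)\,dt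 .$$ The modulus of continuity is $\omega(f;\delta)=\sup\{|f(t)-f(s)|: s,t\in[0,\infty),\ |t-s|\le\delta\}$ for $\delta>0$. *)

theory Defs
  imports "HOL-Analysis.Analysis"
begin

definition theta :: "nat \<Rightarrow> real" where
  "theta k = (if even k then 0 else 1)"

text \<open>The two cases of the coefficients, indexed by \<open>2j\<close> and \<open>2j + 1\<close>, are merged
  into one function of \<open>k\<close> with \<open>j = k div 2\<close>.\<close>

definition dunkl_gamma :: "real \<Rightarrow> nat \<Rightarrow> real" where
  "dunkl_gamma \<mu> k =
     (if even k
      then 2 ^ k * fact (k div 2) * Gamma (real (k div 2) + \<mu> + 1 / 2) / Gamma (\<mu> + 1 / 2)
      else 2 ^ k * fact (k div 2) * Gamma (real (k div 2) + \<mu> + 3 / 2) / Gamma (\<mu> + 1 / 2))"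

lemma dunkl_gamma_Suc:
  assumes "\<mu> \<ge> 0"
  shows "dunkl_gamma \<mu> (k + 1) = (real k + 1 + 2 * \<mu> * theta (k + 1)) * dunkl_gamma \<mu> k"
proof (cases "even k")
  case True
  then obtain j where k: "k = 2 * j" by blast
  have "Gamma (real j + \<mu> + 1 / 2 + 1) = (real j + \<mu> + 1 / 2) * Gamma (real j + \<mu> + 1 / 2)"
    using assms by (intro Gamma_plus1) (auto elim!: nonpos_Ints_cases)
  moreover have "real j + \<mu> + 1 / 2 + 1 = real j + \<mu> + 3 / 2"
    by simp
  ultimately show ?thesis
    by (simp add: k dunkl_gamma_def theta_def algebra_simps add_divide_distrib)
next
  case False
  then obtain j where k: "k = 2 * j + 1" using oddE by blast
  have "real (Suc j) + \<mu> + 1 / 2 = real j + \<mu> + 3 / 2"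
    by simp
  then show ?thesis
    by (simp add: k dunkl_gamma_def theta_def algebra_simps add_divide_distrib)
qed

definition dunkl_exp :: "real \<Rightarrow> real \<Rightarrow> real" where
  "dunkl_exp \<mu> x = (\<Sum>k. x ^ k / dunkl_gamma \<mu> k)"

definition r_seq :: "nat \<Rightarrow> real \<Rightarrow> real" where
  "r_seq n x = x - 1 / (2 * real n)"

definition K_star :: "real \<Rightarrow> real \<Rightarrow> real \<Rightarrow> nat \<Rightarrow> (real \<Rightarrow> real) \<Rightarrow> real \<Rightarrow> real" where
  "K_star \<mu> \<alpha> \<beta> n f x =
     real n / dunkl_exp \<mu> (real n * r_seq n x) *
     (\<Sum>k. (real n * r_seq n x) ^ k / dunkl_gamma \<mu> k *
        integral {(real k + 2 * \<mu> * theta k) / real n .. (real k + 1 + 2 * \<mu> * theta k) / real n}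
          (\<lambda>t. f ((real n * t + \<alpha>) / (real n + \<beta>))))"

text \<open>The supremum is taken in the reals, so it is meaningful only when the set of
  differences is bounded above, for instance for \<open>f\<close> bounded on the half-line.\<close>

definition modulus_cont :: "(real \<Rightarrow> real) \<Rightarrow> real \<Rightarrow> real" where
  "modulus_cont f \<delta> = Sup {\<bar>f t - f s\<bar> | t s. t \<in> {0..} \<and> s \<in> {0..} \<and> \<bar>t - s\<bar> \<le> \<delta>}"

definition delta_star :: "real \<Rightarrow> real \<Rightarrow> real \<Rightarrow> nat \<Rightarrow> real \<Rightarrow> real" where
  "delta_star \<mu> \<alpha> \<beta> n x =
     sqrt (1 / (real n + \<beta>)\<^sup>2 *
       (\<beta>\<^sup>2 * x\<^sup>2
        + (real n - 2 * \<alpha> * \<beta>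
           + 2 * real n * \<mu> * (dunkl_exp \<mu> (- (real n * r_seq n x)) / dunkl_exp \<mu> (real n * r_seq n x))) * x
        + \<alpha>\<^sup>2
        - (5 / 12 + \<mu> * (dunkl_exp \<mu> (- (real n * r_seq n x)) / dunkl_exp \<mu> (real n * r_seq n x)))))"

end

theory Submission
  imports Defs
begin

text \<open>
  The operator is an average: \<open>K_star\<close> integrates \<open>f\<close> against the probability measure that first
  chooses \<open>k\<close> with probability \<open>y ^ k / (dunkl_gamma \<mu> k * dunkl_exp \<mu> y)\<close>, where
  \<open>y = n x - 1/2\<close>, and then a point \<open>(s + \<alpha>) / (n + \<beta>)\<close> with \<open>s\<close> uniform on
  \<open>[a, a + 1]\<close>, \<open>a = k + 2 \<mu> \<theta>(k)\<close>. The choice \<open>r_n(x) = x - 1/(2n)\<close>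
  makes \<open>n x\<close> the mean of \<open>s\<close>, and \<open>\<delta> = delta_star\<close> turns out to be exactly the root mean
  square distance from \<open>x\<close> to the random point.

  Two facts give the theorem. The modulus of continuity satisfies
  \<open>\<bar>f t - f x\<bar> \<le> (1 + (t - x)\<^sup>2 / \<delta>\<^sup>2) \<omega>(\<delta>)\<close> (lemma \<open>modulus_cont_quadratic\<close>), because
  a path from \<open>x\<close> to \<open>t\<close> can be cut into at most \<open>1 + (t - x)\<^sup>2 / \<delta>\<^sup>2\<close> pieces of length at
  most \<open>\<delta>\<close>; averaging the right-hand side gives \<open>(1 + 1) \<omega>(\<delta>)\<close>, since the mean of
  \<open>(t - x)\<^sup>2\<close> is \<open>\<delta>\<^sup>2\<close>.

  The second moment (lemma \<open>dunkl_node_second_moment\<close>) follows from the recursion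
  \<open>\<gamma>(k + 1) = a(k + 1) \<gamma>(k)\<close>: multiplying the \<open>k\<close>-th weight by the node \<open>a(k)\<close> shifts
  the series by one place and brings out a factor \<open>y\<close>. As
  \<open>a(k + 1) = a(k) + 1 + 2 \<mu> (-1) ^ k\<close>, the second shift produces the alternating series
  \<open>dunkl_exp \<mu> (- y)\<close>, which is the source of the quotient in \<open>delta_star\<close>.
\<close>

section \<open>The modulus of continuity\<close>

lemma abs_diff_le_modulus_cont:
  assumes "bounded (f ` {0..})" "s \<ge> 0" "t \<ge> 0" "\<bar>t - s\<bar> \<le> \<delta>"
  shows "\<bar>f t - f s\<bar> \<le> modulus_cont f \<delta>"
proof -
  obtain M where M: "\<And>z. z \<ge> 0 \<Longrightarrow> \<bar>f z\<bar> \<le> M"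
    using assms(1) by (auto simp: bounded_iff)
  have "\<bar>f v - f u\<bar> \<le> 2 * M" if "u \<ge> 0" "v \<ge> 0" for u v
    using M[OF that(1)] M[OF that(2)] by linarith
  then have "bdd_above {\<bar>f t - f s\<bar> | t s. t \<in> {0..} \<and> s \<in> {0..} \<and> \<bar>t - s\<bar> \<le> \<delta>}"
    by (intro bdd_aboveI[of _ "2 * M"]) auto
  then show ?thesis
    unfolding modulus_cont_def by (rule cSup_upper[rotated]) (use assms in auto)
qed

lemma modulus_cont_nonneg:
  assumes "bounded (f ` {0..})" "\<delta> \<ge> 0"
  shows "modulus_cont f \<delta> \<ge> 0"
  using abs_diff_le_modulus_cont[of f 0 0 \<delta>] assms by simp

text \<open>Walk from \<open>s\<close> towards \<open>t\<close> in steps of equal length; the intermediate points stay in the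
  half-line because it is convex.\<close>

lemma abs_diff_le_mult_modulus_cont:
  assumes "bounded (f ` {0..})" "s \<ge> 0" "t \<ge> 0" "\<bar>t - s\<bar> \<le> real m * \<delta>"
  shows "\<bar>f t - f s\<bar> \<le> real m * modulus_cont f \<delta>"
  using assms(3,4)
proof (induction m arbitrary: t)
  case 0
  then show ?case by simp
next
  case (Suc m)
  define u where "u = s + (real m / real (Suc m)) * (t - s)"
  have u_eq: "u = (1 - real m / real (Suc m)) * s + (real m / real (Suc m)) * t"
    by (simp add: u_def algebra_simps diff_divide_distrib)
  have "u \<ge> 0"
    unfolding u_eq using assms(2) Suc.prems(1) by (intro add_nonneg_nonneg mult_nonneg_nonneg) auto
  have us: "\<bar>u - s\<bar> \<le> real m * \<delta>"
  proof -
    have "\<bar>u - s\<bar> = real m / real (Suc m) * \<bar>t - s\<bar>"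
      by (simp add: u_def abs_mult)
    also have "\<dots> \<le> real m / real (Suc m) * (real (Suc m) * \<delta>)"
      using Suc.prems(2) by (intro mult_left_mono) auto
    finally show ?thesis by simp
  qed
  have tu: "\<bar>t - u\<bar> \<le> \<delta>"
  proof -
    have "t - u = (t - s) / real (Suc m)"
      by (simp add: u_def field_simps)
    then have "\<bar>t - u\<bar> = \<bar>t - s\<bar> / real (Suc m)"
      by simp
    also have "\<dots> \<le> \<delta>"
      using Suc.prems(2) by (simp add: divide_le_eq mult.commute)
    finally show ?thesis .
  qed
  have "\<bar>f t - f s\<bar> \<le> \<bar>f t - f u\<bar> + \<bar>f u - f s\<bar>"
    by linarith
  also have "\<dots> \<le> modulus_cont f \<delta> + real m * modulus_cont f \<delta>"
    using Suc.IH[OF \<open>u \<ge> 0\<close> us]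
      abs_diff_le_modulus_cont[OF assms(1) \<open>u \<ge> 0\<close> Suc.prems(1) tu]
    by linarith
  finally show ?case by (simp add: algebra_simps)
qed

text \<open>For \<open>v = \<bar>t - s\<bar> / \<delta>\<close>, at most \<open>\<lceil>v\<rceil>\<close> steps of length \<open>\<delta>\<close> are needed, and
  \<open>\<lceil>v\<rceil> \<le> 1 + v\<^sup>2\<close>.\<close>

lemma modulus_cont_quadratic:
  assumes "bounded (f ` {0..})" "s \<ge> 0" "t \<ge> 0" "\<delta> > 0"
  shows "\<bar>f t - f s\<bar> \<le> (1 + (t - s)\<^sup>2 / \<delta>\<^sup>2) * modulus_cont f \<delta>"
proof -
  define v where "v = \<bar>t - s\<bar> / \<delta>"
  define m where "m = nat \<lceil>v\<rceil>"
  have "v \<ge> 0"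
    using assms(4) by (simp add: v_def)
  then have m: "real m = of_int \<lceil>v\<rceil>"
    by (simp add: m_def)
  have "\<bar>t - s\<bar> = v * \<delta>"
    using assms(4) by (simp add: v_def)
  also have "\<dots> \<le> real m * \<delta>"
    unfolding m using assms(4) by (intro mult_right_mono) auto
  finally have "\<bar>f t - f s\<bar> \<le> real m * modulus_cont f \<delta>"
    by (rule abs_diff_le_mult_modulus_cont[OF assms(1-3)])
  moreover have "real m \<le> 1 + v\<^sup>2"
  proof (cases "v \<le> 1")
    case True
    then have "\<lceil>v\<rceil> \<le> 1" by (simp add: ceiling_le_iff)
    then have "real m \<le> 1" unfolding m by simp
    then show ?thesis by (rule order_trans) simp
  next
    case False
    then have "v \<le> v\<^sup>2" by (simp add: power2_eq_square)
    moreover have "real m < v + 1" unfolding m by linarith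
    ultimately show ?thesis by linarith
  qed
  moreover have "v\<^sup>2 = (t - s)\<^sup>2 / \<delta>\<^sup>2"
    by (simp add: v_def power_divide)
  ultimately show ?thesis
    using mult_right_mono[of "real m" "1 + v\<^sup>2" "modulus_cont f \<delta>"]
      modulus_cont_nonneg[OF assms(1), of \<delta>] assms(4) by simp
qed

section \<open>Moments of the weights of the Dunkl exponential\<close>

definition dunkl_node :: "real \<Rightarrow> nat \<Rightarrow> real" where
  "dunkl_node \<mu> k = real k + 2 * \<mu> * theta k"

lemma dunkl_node_0 [simp]: "dunkl_node \<mu> 0 = 0"
  by (simp add: dunkl_node_def theta_def)

lemma dunkl_node_ge:
  assumes "\<mu> \<ge> 0"
  shows "dunkl_node \<mu> k \<ge> real k"
  using assms by (simp add: dunkl_node_def theta_def)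

lemma dunkl_node_Suc: "dunkl_node \<mu> (Suc k) = dunkl_node \<mu> k + 1 + 2 * \<mu> * (- 1) ^ k"
  by (simp add: dunkl_node_def theta_def)

lemma dunkl_gamma_Suc_node:
  assumes "\<mu> \<ge> 0"
  shows "dunkl_gamma \<mu> (Suc k) = dunkl_node \<mu> (Suc k) * dunkl_gamma \<mu> k"
  using dunkl_gamma_Suc[OF assms, of k] by (simp add: dunkl_node_def add.commute)

lemma dunkl_gamma_0:
  assumes "\<mu> \<ge> 0"
  shows "dunkl_gamma \<mu> 0 = 1"
proof -
  have "Gamma (\<mu> + 1 / 2) > 0"
    using assms by (intro Gamma_real_pos) simp
  then show ?thesis by (simp add: dunkl_gamma_def)
qed

lemma fact_le_dunkl_gamma:
  assumes "\<mu> \<ge> 0"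
  shows "fact k \<le> dunkl_gamma \<mu> k"
proof (induction k)
  case 0
  then show ?case by (simp add: dunkl_gamma_0[OF assms])
next
  case (Suc k)
  have "real (Suc k) * fact k \<le> dunkl_node \<mu> (Suc k) * dunkl_gamma \<mu> k"
    using Suc dunkl_node_ge[OF assms, of "Suc k"] by (intro mult_mono) auto
  then show ?case by (simp add: dunkl_gamma_Suc_node[OF assms])
qed

lemma dunkl_gamma_pos:
  assumes "\<mu> \<ge> 0"
  shows "dunkl_gamma \<mu> k > 0"
  using fact_le_dunkl_gamma[OF assms, of k] fact_gt_zero[of k, where 'a = real] by linarith

lemma dunkl_exp_sums:
  assumes "\<mu> \<ge> 0"
  shows "(\<lambda>k. x ^ k / dunkl_gamma \<mu> k) sums dunkl_exp \<mu> x"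
proof -
  have "summable (\<lambda>k. \<bar>x\<bar> ^ k / fact k)"
    using summable_exp[of "\<bar>x\<bar>"] by (simp add: field_simps)
  moreover have "norm (x ^ k / dunkl_gamma \<mu> k) \<le> \<bar>x\<bar> ^ k / fact k" for k
    using fact_le_dunkl_gamma[OF assms, of k] dunkl_gamma_pos[OF assms, of k]
    by (auto simp: abs_mult power_abs intro!: divide_left_mono)
  ultimately have "summable (\<lambda>k. x ^ k / dunkl_gamma \<mu> k)"
    by (rule summable_comparison_test'[where N = 0])
  then show ?thesis
    unfolding dunkl_exp_def by (rule summable_sums)
qed

lemma dunkl_exp_pos:
  assumes "\<mu> \<ge> 0" "x \<ge> 0"
  shows "dunkl_exp \<mu> x > 0"
proof -
  have "(\<Sum>k\<in>{0}. x ^ k / dunkl_gamma \<mu> k) \<le> dunkl_exp \<mu> x"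
    unfolding dunkl_exp_def using dunkl_exp_sums[OF assms(1), of x] assms dunkl_gamma_pos[OF assms(1)]
    by (intro sum_le_suminf) (auto simp: sums_iff intro!: divide_nonneg_pos)
  then show ?thesis by (simp add: dunkl_gamma_0[OF assms(1)])
qed

text \<open>Since \<open>\<gamma>(k + 1) = a(k + 1) \<gamma>(k)\<close> and \<open>a(0) = 0\<close>, a factor \<open>a(k)\<close> in front of the
  weights cancels against \<open>\<gamma>(k)\<close> and shifts the index. Both moments below are instances.\<close>

lemma dunkl_node_shift:
  assumes "\<mu> \<ge> 0" and "(\<lambda>k. g (Suc k) * (y ^ k / dunkl_gamma \<mu> k)) sums S"
  shows "(\<lambda>k. g k * dunkl_node \<mu> k * (y ^ k / dunkl_gamma \<mu> k)) sums (y * S)"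
proof -
  have "dunkl_node \<mu> (Suc k) \<noteq> 0" for k
    using dunkl_node_ge[OF assms(1), of "Suc k"] by simp
  then have "g (Suc k) * dunkl_node \<mu> (Suc k) * (y ^ Suc k / dunkl_gamma \<mu> (Suc k)) =
      y * (g (Suc k) * (y ^ k / dunkl_gamma \<mu> k))" for k
    by (simp add: dunkl_gamma_Suc_node[OF assms(1)])
  then have "(\<lambda>k. g (Suc k) * dunkl_node \<mu> (Suc k) * (y ^ Suc k / dunkl_gamma \<mu> (Suc k))) sums (y * S)"
    using sums_mult[OF assms(2), of y] by simp
  then show ?thesis
    by (subst (asm) sums_Suc_iff) simp
qed

lemma dunkl_node_first_moment:
  assumes "\<mu> \<ge> 0"
  shows "(\<lambda>k. dunkl_node \<mu> k * (y ^ k / dunkl_gamma \<mu> k)) sums (y * dunkl_exp \<mu> y)"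
  using dunkl_node_shift[OF assms, of "\<lambda>_. 1"] dunkl_exp_sums[OF assms, of y] by simp

lemma dunkl_node_second_moment:
  assumes "\<mu> \<ge> 0"
  shows "(\<lambda>k. (dunkl_node \<mu> k)\<^sup>2 * (y ^ k / dunkl_gamma \<mu> k)) sums
    (y * ((y + 1) * dunkl_exp \<mu> y + 2 * \<mu> * dunkl_exp \<mu> (- y)))"
proof -
  have "(\<lambda>k. dunkl_node \<mu> k * (y ^ k / dunkl_gamma \<mu> k) + y ^ k / dunkl_gamma \<mu> k
        + 2 * \<mu> * ((- y) ^ k / dunkl_gamma \<mu> k)) sums
      (y * dunkl_exp \<mu> y + dunkl_exp \<mu> y + 2 * \<mu> * dunkl_exp \<mu> (- y))"
    by (intro sums_add sums_mult dunkl_node_first_moment dunkl_exp_sums assms)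
  moreover have "dunkl_node \<mu> k * (y ^ k / dunkl_gamma \<mu> k) + y ^ k / dunkl_gamma \<mu> k
        + 2 * \<mu> * ((- y) ^ k / dunkl_gamma \<mu> k) =
      dunkl_node \<mu> (Suc k) * (y ^ k / dunkl_gamma \<mu> k)" for k
    by (simp add: dunkl_node_Suc power_minus[of y] algebra_simps add_divide_distrib)
  ultimately have "(\<lambda>k. dunkl_node \<mu> (Suc k) * (y ^ k / dunkl_gamma \<mu> k)) sums
      ((y + 1) * dunkl_exp \<mu> y + 2 * \<mu> * dunkl_exp \<mu> (- y))"
    by (simp add: algebra_simps)
  from dunkl_node_shift[OF assms this] show ?thesis
    by (simp add: power2_eq_square)
qed

section \<open>Averages over one cell\<close>

text \<open>After the substitution \<open>s = n t\<close>, this is the integral of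
  \<open>((s + \<alpha>) / (n + \<beta>) - x)\<^sup>2\<close> over \<open>[a, a + 1]\<close>, split into the square of its mean
  deviation and the variance \<open>1/12\<close> of a uniform variable.\<close>

lemma cell_second_moment:
  fixes N a \<alpha> \<beta> x :: real
  assumes "N > 0" "\<beta> \<ge> 0"
  shows "((\<lambda>t. ((N * t + \<alpha>) / (N + \<beta>) - x)\<^sup>2) has_integral
    (((a + 1 / 2 - ((N + \<beta>) * x - \<alpha>))\<^sup>2 + 1 / 12) / (N + \<beta>)\<^sup>2 / N)) {a / N .. (a + 1) / N}"
proof -
  define F where "F t = ((N * t + \<alpha>) / (N + \<beta>) - x) ^ 3 * (N + \<beta>) / (3 * N)" for t
  have pos: "N + \<beta> > 0" using assms by simp
  have "(F has_vector_derivative ((N * t + \<alpha>) / (N + \<beta>) - x)\<^sup>2)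
      (at t within {a / N .. (a + 1) / N})" for t
    unfolding F_def has_real_derivative_iff_has_vector_derivative[symmetric]
    by (rule derivative_eq_intros refl | use assms pos in \<open>simp add: power2_eq_square\<close>)+
  then have "((\<lambda>t. ((N * t + \<alpha>) / (N + \<beta>) - x)\<^sup>2) has_integral
      (F ((a + 1) / N) - F (a / N))) {a / N .. (a + 1) / N}"
    using assms by (intro fundamental_theorem_of_calculus) (auto simp: divide_right_mono)
  moreover have "F ((a + 1) / N) - F (a / N) =
      ((a + 1 / 2 - ((N + \<beta>) * x - \<alpha>))\<^sup>2 + 1 / 12) / (N + \<beta>)\<^sup>2 / N"
  proof -
    define c where "c = (N + \<beta>) * x - \<alpha>"
    have "(s + \<alpha>) / (N + \<beta>) - x = (s - c) / (N + \<beta>)" for s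
      using pos by (simp add: c_def field_simps)
    then have "F (s / N) = (s - c) ^ 3 / (3 * (N + \<beta>)\<^sup>2 * N)" for s
      unfolding F_def using assms pos by (simp add: power_divide power2_eq_square power3_eq_cube)
    then have "F ((a + 1) / N) - F (a / N) =
        ((a + 1 - c) ^ 3 - (a - c) ^ 3) / (3 * (N + \<beta>)\<^sup>2 * N)"
      by (simp add: diff_divide_distrib)
    also have "(a + 1 - c) ^ 3 - (a - c) ^ 3 = 3 * ((a + 1 / 2 - c)\<^sup>2 + 1 / 12)"
      by (simp add: power2_eq_square power3_eq_cube algebra_simps)
    also have "3 * v / (3 * (N + \<beta>)\<^sup>2 * N) = v / (N + \<beta>)\<^sup>2 / N" for v :: real
      by simp
    finally show ?thesis
      by (simp only: c_def)
  qed
  ultimately show ?thesis by simp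
qed

lemma cell_average_deviation:
  fixes N a \<alpha> \<beta> x \<delta> :: real
  assumes "N > 0" "a \<ge> 0" "\<alpha> \<ge> 0" "\<beta> \<ge> 0" "x \<ge> 0" "\<delta> > 0"
    and f: "continuous_on {0..} f" "bounded (f ` {0..})"
  shows "\<bar>N * integral {a / N .. (a + 1) / N} (\<lambda>t. f ((N * t + \<alpha>) / (N + \<beta>))) - f x\<bar>
    \<le> (1 + ((a + 1 / 2 - ((N + \<beta>) * x - \<alpha>))\<^sup>2 + 1 / 12) / (N + \<beta>)\<^sup>2 / \<delta>\<^sup>2) * modulus_cont f \<delta>"
proof -
  let ?I = "{a / N .. (a + 1) / N}"
  let ?\<phi> = "\<lambda>t. (N * t + \<alpha>) / (N + \<beta>)"
  let ?V = "((a + 1 / 2 - ((N + \<beta>) * x - \<alpha>))\<^sup>2 + 1 / 12) / (N + \<beta>)\<^sup>2"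
  let ?\<omega> = "modulus_cont f \<delta>"
  have \<phi>: "?\<phi> t \<ge> 0" if "t \<in> ?I" for t
  proof -
    have "t \<ge> 0"
      using that assms(1,2) by (auto intro: order_trans[OF divide_nonneg_pos])
    then show ?thesis using assms by auto
  qed
  have const: "((\<lambda>_. c) has_integral (c / N)) ?I" for c :: real
    using has_integral_const_real[of c "a / N" "(a + 1) / N"] assms(1)
    by (simp add: divide_right_mono add_divide_distrib)
  have "continuous_on ?I (\<lambda>t. f (?\<phi> t))"
    using assms \<phi> by (intro continuous_on_compose2[OF f(1)] continuous_intros) auto
  then have int_f: "(\<lambda>t. f (?\<phi> t)) integrable_on ?I"
    by (rule integrable_continuous_real)
  have diff: "((\<lambda>t. f (?\<phi> t) - f x) has_integral (integral ?I (\<lambda>t. f (?\<phi> t)) - f x / N)) ?I"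
    by (intro has_integral_diff integrable_integral[OF int_f] const)
  have bound: "((\<lambda>t. (1 + (?\<phi> t - x)\<^sup>2 / \<delta>\<^sup>2) * ?\<omega>) has_integral
      ((1 / N + (?V / N) / \<delta>\<^sup>2) * ?\<omega>)) ?I"
    using assms
    by (intro has_integral_mult_left has_integral_add const has_integral_divide cell_second_moment)
      auto
  have "norm (integral ?I (\<lambda>t. f (?\<phi> t) - f x)) \<le>
      integral ?I (\<lambda>t. (1 + (?\<phi> t - x)\<^sup>2 / \<delta>\<^sup>2) * ?\<omega>)"
    using diff bound \<phi> modulus_cont_quadratic[OF f(2) assms(5) _ assms(6)]
    by (intro integral_norm_bound_integral) (auto simp: has_integral_integrable)
  then have "\<bar>integral ?I (\<lambda>t. f (?\<phi> t)) - f x / N\<bar> \<le> (1 / N + (?V / N) / \<delta>\<^sup>2) * ?\<omega>"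
    unfolding integral_unique[OF diff] integral_unique[OF bound] by simp
  then have "N * \<bar>integral ?I (\<lambda>t. f (?\<phi> t)) - f x / N\<bar> \<le>
      N * ((1 / N + (?V / N) / \<delta>\<^sup>2) * ?\<omega>)"
    using assms(1) by (intro mult_left_mono) auto
  moreover have "N * \<bar>integral ?I (\<lambda>t. f (?\<phi> t)) - f x / N\<bar> =
      \<bar>N * integral ?I (\<lambda>t. f (?\<phi> t)) - f x\<bar>"
    using assms(1) by (simp add: abs_mult_pos' right_diff_distrib)
  moreover have "N * ((1 / N + (?V / N) / \<delta>\<^sup>2) * ?\<omega>) = (1 + ?V / \<delta>\<^sup>2) * ?\<omega>"
  proof -
    have "N * ((1 / N + (v / N) / \<delta>\<^sup>2) * w) = (1 + v / \<delta>\<^sup>2) * w" for v w :: real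
      using assms(1) by (simp add: distrib_left distrib_right)
    then show ?thesis .
  qed
  ultimately show ?thesis by (simp only:)
qed

section \<open>The rate of approximation\<close>

text \<open>The quantity under the root in \<open>delta_star\<close> is the mean square deviation of the random
  point from \<open>x\<close>. It is positive because the
  uniform choice inside each cell already contributes the variance \<open>1/12\<close>, scaled by
  \<open>1 / (n + \<beta>)\<^sup>2\<close>.\<close>

lemma delta_star_second_moment:
  fixes \<mu> \<alpha> \<beta> x :: real and n :: nat
  assumes "\<mu> \<ge> 0" "\<beta> \<ge> 0" "x \<ge> 1 / 2" "n \<ge> 1"
  defines "y \<equiv> real n * r_seq n x"
  defines "V \<equiv> \<lambda>k. ((dunkl_node \<mu> k + 1 / 2 - ((real n + \<beta>) * x - \<alpha>))\<^sup>2 + 1 / 12) / (real n + \<beta>)\<^sup>2"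
  shows "(\<lambda>k. V k * (y ^ k / dunkl_gamma \<mu> k)) sums
      ((delta_star \<mu> \<alpha> \<beta> n x)\<^sup>2 * dunkl_exp \<mu> y)"
    and "delta_star \<mu> \<alpha> \<beta> n x > 0"
proof -
  define N where "N = real n"
  define a where "a = dunkl_node \<mu>"
  define w where "w k = y ^ k / dunkl_gamma \<mu> k" for k
  define E where "E = dunkl_exp \<mu> y"
  define E' where "E' = dunkl_exp \<mu> (- y)"
  define c where "c = (N + \<beta>) * x - \<alpha>"
  define D where "D = 1 / (N + \<beta>)\<^sup>2 * (\<beta>\<^sup>2 * x\<^sup>2 + (N - 2 * \<alpha> * \<beta> + 2 * N * \<mu> * (E' / E)) * x
        + \<alpha>\<^sup>2 - (5 / 12 + \<mu> * (E' / E)))"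
  have "N \<ge> 1" using assms(4) by (simp add: N_def)
  have y: "y = N * x - 1 / 2"
    using \<open>N \<ge> 1\<close> by (simp add: y_def r_seq_def N_def right_diff_distrib)
  have "1 * (1 / 2) \<le> N * x"
    using \<open>N \<ge> 1\<close> assms(3) by (intro mult_mono) auto
  then have "y \<ge> 0" by (simp add: y)
  then have "E > 0" unfolding E_def by (rule dunkl_exp_pos[OF assms(1)])
  have pos: "(N + \<beta>)\<^sup>2 > 0" using \<open>N \<ge> 1\<close> assms(2) by simp
  have delta: "delta_star \<mu> \<alpha> \<beta> n x = sqrt D"
    by (simp add: delta_star_def D_def E_def E'_def y_def N_def)
  have s0: "w sums E"
    using dunkl_exp_sums[OF assms(1), of y] by (simp add: w_def[abs_def] E_def)
  have s1: "(\<lambda>k. a k * w k) sums (y * E)"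
    using dunkl_node_first_moment[OF assms(1), of y] by (simp add: w_def a_def E_def)
  have s2: "(\<lambda>k. (a k)\<^sup>2 * w k) sums (y * ((y + 1) * E + 2 * \<mu> * E'))"
    using dunkl_node_second_moment[OF assms(1), of y] by (simp add: w_def a_def E_def E'_def)
  have "(\<lambda>k. ((a k)\<^sup>2 * w k + (1 - 2 * c) * (a k * w k) + (1 / 3 - c + c\<^sup>2) * w k) / (N + \<beta>)\<^sup>2) sums
      ((y * ((y + 1) * E + 2 * \<mu> * E') + (1 - 2 * c) * (y * E) + (1 / 3 - c + c\<^sup>2) * E) / (N + \<beta>)\<^sup>2)"
    by (intro sums_divide sums_add sums_mult s0 s1 s2)
  moreover have "((a k)\<^sup>2 * w k + (1 - 2 * c) * (a k * w k) + (1 / 3 - c + c\<^sup>2) * w k) / (N + \<beta>)\<^sup>2 =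
      V k * w k" for k
  proof -
    have "(a k)\<^sup>2 * w k + (1 - 2 * c) * (a k * w k) + (1 / 3 - c + c\<^sup>2) * w k =
        ((a k + 1 / 2 - c)\<^sup>2 + 1 / 12) * w k"
      by (simp add: power2_eq_square algebra_simps)
    then show ?thesis by (simp add: V_def a_def c_def N_def)
  qed
  moreover have "(y * ((y + 1) * E + 2 * \<mu> * E') + (1 - 2 * c) * (y * E) + (1 / 3 - c + c\<^sup>2) * E)
      / (N + \<beta>)\<^sup>2 = D * E"
  proof -
    \<comment> \<open>The constant \<open>5/12\<close> arises as \<open>2/3 - 1/4\<close> from
      \<open>y\<^sup>2 + 2 y + 1/3 = (N x + 1/2)\<^sup>2 - 2/3\<close>, and \<open>c - N x = \<beta> x - \<alpha>\<close>.\<close>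
    define q where "q = E' / E"
    have E': "E' = q * E" using \<open>E > 0\<close> by (simp add: q_def)
    have "y * ((y + 1) * E + 2 * \<mu> * E') + (1 - 2 * c) * (y * E) + (1 / 3 - c + c\<^sup>2) * E =
        (\<beta>\<^sup>2 * x\<^sup>2 + (N - 2 * \<alpha> * \<beta> + 2 * N * \<mu> * q) * x + \<alpha>\<^sup>2 - (5 / 12 + \<mu> * q)) * E"
      unfolding E' y c_def by (simp add: power2_eq_square algebra_simps)
    then show ?thesis by (simp add: D_def q_def)
  qed
  ultimately have sV: "(\<lambda>k. V k * w k) sums (D * E)" by simp
  have "1 / 12 / (N + \<beta>)\<^sup>2 * w k \<le> V k * w k" for k
    unfolding V_def N_def[symmetric]
    using \<open>y \<ge> 0\<close> dunkl_gamma_pos[OF assms(1), of k]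
    by (intro mult_right_mono divide_right_mono) (simp_all add: w_def)
  then have "1 / 12 / (N + \<beta>)\<^sup>2 * E \<le> D * E"
    by (rule sums_le[OF _ sums_mult[OF s0] sV])
  moreover have "1 / 12 / (N + \<beta>)\<^sup>2 * E > 0"
    using pos \<open>E > 0\<close> by (intro mult_pos_pos divide_pos_pos) auto
  ultimately have "D * E > 0" by linarith
  then have "D > 0" using \<open>E > 0\<close> by (simp add: zero_less_mult_iff)
  then show "delta_star \<mu> \<alpha> \<beta> n x > 0" by (simp add: delta)
  show "(\<lambda>k. V k * (y ^ k / dunkl_gamma \<mu> k)) sums ((delta_star \<mu> \<alpha> \<beta> n x)\<^sup>2 * dunkl_exp \<mu> y)"
    using sV \<open>D > 0\<close> by (simp add: delta w_def E_def)
qed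

theorem theorem4p2:
  fixes \<mu> \<alpha> \<beta> x :: real and n :: nat and f :: "real \<Rightarrow> real"
  assumes "\<mu> \<ge> 0" and "\<alpha> \<ge> 0" and "\<beta> \<ge> 0"
    and "uniformly_continuous_on {0..} f"
    and "bounded (f ` {0..})"
    and "x \<ge> 1 / 2"
    and "n \<ge> 1"
  shows "\<bar>K_star \<mu> \<alpha> \<beta> n f x - f x\<bar> \<le> 2 * modulus_cont f (delta_star \<mu> \<alpha> \<beta> n x)"
proof -
  define N where "N = real n"
  define y where "y = N * r_seq n x"
  define a where "a = dunkl_node \<mu>"
  define w where "w k = y ^ k / dunkl_gamma \<mu> k" for k
  define E where "E = dunkl_exp \<mu> y"
  define \<delta> where "\<delta> = delta_star \<mu> \<alpha> \<beta> n x"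
  define \<omega> where "\<omega> = modulus_cont f \<delta>"
  define V where "V k = ((a k + 1 / 2 - ((N + \<beta>) * x - \<alpha>))\<^sup>2 + 1 / 12) / (N + \<beta>)\<^sup>2" for k
  define J where "J k = integral {a k / N .. (a k + 1) / N} (\<lambda>t. f ((N * t + \<alpha>) / (N + \<beta>)))" for k
  have "N \<ge> 1" using assms(7) by (simp add: N_def)
  have "1 * (1 / 2) \<le> N * x"
    using \<open>N \<ge> 1\<close> assms(6) by (intro mult_mono) auto
  moreover have "y = N * x - 1 / 2"
    using \<open>N \<ge> 1\<close> by (simp add: y_def r_seq_def N_def right_diff_distrib)
  ultimately have "y \<ge> 0" by simp
  then have "E > 0" unfolding E_def by (rule dunkl_exp_pos[OF assms(1)])
  have w_nonneg: "w k \<ge> 0" for k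
    using \<open>y \<ge> 0\<close> dunkl_gamma_pos[OF assms(1), of k] by (simp add: w_def)
  have sw: "w sums E"
    using dunkl_exp_sums[OF assms(1), of y] by (simp add: w_def[abs_def] E_def)
  have "\<delta> > 0" and sV: "(\<lambda>k. V k * w k) sums (\<delta>\<^sup>2 * E)"
    using delta_star_second_moment[OF assms(1,3,6,7), of \<alpha>]
    by (simp_all add: \<delta>_def V_def a_def w_def E_def y_def N_def)
  have term_le: "norm (N * (w k * J k) - w k * f x) \<le> (w k + V k * w k / \<delta>\<^sup>2) * \<omega>" for k
  proof -
    have "a k \<ge> 0"
      using dunkl_node_ge[OF assms(1), of k] by (simp add: a_def)
    then have "\<bar>N * J k - f x\<bar> \<le> (1 + V k / \<delta>\<^sup>2) * \<omega>"
      unfolding J_def V_def \<omega>_def using \<open>N \<ge> 1\<close> \<open>\<delta> > 0\<close> assms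
      by (intro cell_average_deviation uniformly_continuous_imp_continuous) auto
    then have "w k * \<bar>N * J k - f x\<bar> \<le> w k * ((1 + V k / \<delta>\<^sup>2) * \<omega>)"
      by (rule mult_left_mono[OF _ w_nonneg])
    moreover have "w k * \<bar>N * J k - f x\<bar> = norm (N * (w k * J k) - w k * f x)"
      using w_nonneg[of k] by (simp add: abs_mult_pos' algebra_simps)
    ultimately show ?thesis by (simp add: algebra_simps)
  qed
  have "(\<lambda>k. (w k + V k * w k / \<delta>\<^sup>2) * \<omega>) sums ((E + \<delta>\<^sup>2 * E / \<delta>\<^sup>2) * \<omega>)"
    by (intro sums_mult2 sums_add sums_divide sw sV)
  then have sb: "(\<lambda>k. (w k + V k * w k / \<delta>\<^sup>2) * \<omega>) sums (2 * \<omega> * E)"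
    using \<open>\<delta> > 0\<close> by (simp add: mult_ac)
  \<comment> \<open>The comparison also gives the convergence of the series that defines the operator.\<close>
  have sd: "summable (\<lambda>k. N * (w k * J k) - w k * f x)"
    by (rule summable_comparison_test'[OF sums_summable[OF sb], where N = 0]) (rule term_le)
  have le: "norm (\<Sum>k. N * (w k * J k) - w k * f x) \<le> 2 * \<omega> * E"
    using norm_suminf_le[OF term_le sums_summable[OF sb]] sb by (simp add: sums_iff)
  have swf: "(\<lambda>k. w k * f x) sums (E * f x)"
    by (rule sums_mult2[OF sw])
  have "summable (\<lambda>k. N * (w k * J k))"
    using summable_add[OF sd sums_summable[OF swf]] by simp
  then have "summable (\<lambda>k. w k * J k)"
    using \<open>N \<ge> 1\<close> by (subst (asm) summable_cmult_iff) simp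
  then have "(\<lambda>k. N * (w k * J k) - w k * f x) sums (N * (\<Sum>k. w k * J k) - E * f x)"
    by (intro sums_diff sums_mult summable_sums swf)
  then have "\<bar>N * (\<Sum>k. w k * J k) - E * f x\<bar> \<le> 2 * \<omega> * E"
    using le by (simp add: sums_iff)
  moreover have "K_star \<mu> \<alpha> \<beta> n f x = N * (\<Sum>k. w k * J k) / E"
    by (simp add: K_star_def w_def J_def E_def y_def N_def a_def dunkl_node_def add_ac)
  then have "K_star \<mu> \<alpha> \<beta> n f x - f x = (N * (\<Sum>k. w k * J k) - E * f x) / E"
    using \<open>E > 0\<close> by (simp add: diff_divide_distrib)
  ultimately have "\<bar>K_star \<mu> \<alpha> \<beta> n f x - f x\<bar> \<le> 2 * \<omega>"
    using \<open>E > 0\<close> by (simp add: divide_le_eq)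
  then show ?thesis by (simp add: \<omega>_def \<delta>_def)
qed

end
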